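(* Let $X$ be a two-dimensional one-step shift of finite type. Then $X$ has a vertically periodic point if and only if $X$ has an $(m,n)$-periodic point for some $m,n\in\mathbb{Z}\setminus\{0\}$.
   Context: Let $\mathcal{A}$ be a finite alphabet. A two-dimensional shift space is a set $X_{\mathcal{F}}\subseteq \mathcal{A}^{\mathbb{Z}^2}$ consisting of all $x\in\mathcal{A}^{\mathbb{Z}^2}$ in which no translate of a pattern from a given set $\mathcal{F}$ of finite patterns appears; it is of finite type if $\mathcal{F}$ can be chosen to be finite. It is a one-step shift if $\mathcal{F}$ can be chosen to consist only of pairs of horizontally adjacent symbols and pairs of vertically adjacent symbols. For $u\in\mathbb{Z}^2\setminus\{0\}$, a point $x\in X$ is $u$-periodic if $x(v+u)=x(v)$ for all $v\in\mathbb{Z}^2$. A point is vertically periodic if it is $(0,n)$-periodic for some $n\neq 0$. *)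

theory Defs
  imports Main "HOL-Library.Product_Plus"
begin

type_synonym 'a config = "int \<times> int \<Rightarrow> 'a"
type_synonym 'a pattern = "int \<times> int \<rightharpoonup> 'a"

definition patterns :: "'a set \<Rightarrow> 'a pattern set" where
  "patterns A = {p. finite (dom p) \<and> ran p \<subseteq> A}"

text \<open>A translate of \<open>p\<close> appears in \<open>x\<close>.\<close>
definition occurs_in :: "'a pattern \<Rightarrow> 'a config \<Rightarrow> bool" where
  "occurs_in p x \<longleftrightarrow> (\<exists>v. \<forall>u a. p u = Some a \<longrightarrow> x (v + u) = a)"

definition shift_avoiding :: "'a set \<Rightarrow> 'a pattern set \<Rightarrow> 'a config set" where
  "shift_avoiding A F = {x. range x \<subseteq> A \<and> (\<forall>p\<in>F. \<not> occurs_in p x)}"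

definition shift_of_finite_type :: "'a set \<Rightarrow> 'a config set \<Rightarrow> bool" where
  "shift_of_finite_type A X \<longleftrightarrow> (\<exists>F \<subseteq> patterns A. finite F \<and> X = shift_avoiding A F)"

text \<open>Adjacent pairs are anchored at the origin; since \<^const>\<open>occurs_in\<close> ranges over all
  translates, this is no restriction.\<close>
definition horizontal_pair :: "'a \<Rightarrow> 'a \<Rightarrow> 'a pattern" where
  "horizontal_pair a b = [(0, 0) \<mapsto> a, (1, 0) \<mapsto> b]"

definition vertical_pair :: "'a \<Rightarrow> 'a \<Rightarrow> 'a pattern" where
  "vertical_pair a b = [(0, 0) \<mapsto> a, (0, 1) \<mapsto> b]"

definition adjacent_pairs :: "'a set \<Rightarrow> 'a pattern set" where
  "adjacent_pairs A =
     {horizontal_pair a b | a b. a \<in> A \<and> b \<in> A} \<union> {vertical_pair a b | a b. a \<in> A \<and> b \<in> A}"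

definition one_step_shift :: "'a set \<Rightarrow> 'a config set \<Rightarrow> bool" where
  "one_step_shift A X \<longleftrightarrow> (\<exists>F \<subseteq> adjacent_pairs A. X = shift_avoiding A F)"

lemma adjacent_pairs_subset_patterns: "adjacent_pairs A \<subseteq> patterns A"
  by (auto simp: adjacent_pairs_def patterns_def horizontal_pair_def vertical_pair_def
      ran_def split: if_splits)

lemma one_step_shift_imp_shift_of_finite_type:
  assumes "finite A" "one_step_shift A X"
  shows "shift_of_finite_type A X"
proof -
  have "adjacent_pairs A =
      (\<lambda>(a, b). horizontal_pair a b) ` (A \<times> A) \<union> (\<lambda>(a, b). vertical_pair a b) ` (A \<times> A)"
    by (auto simp: adjacent_pairs_def)
  then have "finite (adjacent_pairs A)"
    using assms(1) by simp
  moreover obtain F where "F \<subseteq> adjacent_pairs A" "X = shift_avoiding A F"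
    using assms(2) unfolding one_step_shift_def by blast
  ultimately have "F \<subseteq> patterns A \<and> finite F \<and> X = shift_avoiding A F"
    using adjacent_pairs_subset_patterns finite_subset by blast
  then show ?thesis
    unfolding shift_of_finite_type_def by blast
qed

definition periodic_point :: "int \<times> int \<Rightarrow> 'a config \<Rightarrow> bool" where
  "periodic_point u x \<longleftrightarrow> u \<noteq> 0 \<and> (\<forall>v. x (v + u) = x v)"

definition vertically_periodic :: "'a config \<Rightarrow> bool" where
  "vertically_periodic x \<longleftrightarrow> (\<exists>n. n \<noteq> 0 \<and> periodic_point (0, n) x)"

end

theory Submission
  imports Defs "HOL-Library.FuncSet"
begin

text \<open>
  A one-step shift with a single period already contains a point with two independent periods,
  and both directions of the equivalence follow from this. Suppose that \<open>x\<close> is \<open>(m, n)\<close>-periodic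
  with \<open>m > 0\<close>. Then \<open>x\<close> is determined by the vertical strip \<open>[0, m) \<times> \<int>\<close>, and it lies in the shift
  exactly when the strip obeys local constraints, each of which relates rows at distance at most
  \<open>\<bar>n\<bar> + 1\<close>: a symbol at the right edge of the strip at height \<open>b\<close> has as its right
  neighbour the symbol at the left edge at height \<open>b - n\<close>. So the strip is a one-dimensional
  sequence of rows over the finite alphabet \<open>A^m\<close> with constraints of bounded range. By the
  pigeonhole principle, two sufficiently long windows of rows, far enough apart, agree, and the segment between them
  can be repeated forever. Gluing copies of the resulting strip along \<open>(m, n)\<close> yields a point with
  periods \<open>(m, n)\<close> and \<open>(0, p)\<close>, where \<open>p > 0\<close> (lemma \<open>doubly_periodic_point_exists\<close>).

  A point with period \<open>(m, n)\<close>, \<open>m \<noteq> 0\<close>, also has the period \<open>(- m, - n)\<close>, so the case \<open>m > 0\<close>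
  suffices, and \<open>(0, p)\<close> is the vertical period required. Conversely, a point with
  the vertical period \<open>(0, n)\<close>, without loss of generality \<open>n > 0\<close>, becomes, after reflection in the diagonal, a point with period
  \<open>(n, 0)\<close>; the construction gives a point with periods \<open>(n, 0)\<close> and \<open>(0, p)\<close>, and reflecting
  back gives a point with period \<open>(p, n)\<close>. The reflection exchanges the horizontal and the vertical
  rules, hence leads to another one-step shift.
\<close>

text \<open>
  Listing the allowed horizontal and vertical neighbours makes the symmetry between the two
  directions explicit, which the anchored forbidden patterns hide.
\<close>
definition neighbour_shift :: "'a set \<Rightarrow> ('a \<times> 'a) set \<Rightarrow> ('a \<times> 'a) set \<Rightarrow> 'a config set" where
  "neighbour_shift A H V =
     {x. range x \<subseteq> A \<and> (\<forall>i j. (x (i, j), x (i + 1, j)) \<in> H \<and> (x (i, j), x (i, j + 1)) \<in> V)}"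

lemma horizontal_pair_eq_Some_iff:
  "horizontal_pair a b u = Some c \<longleftrightarrow> u = (0, 0) \<and> c = a \<or> u = (1, 0) \<and> c = b"
  by (auto simp: horizontal_pair_def)

lemma occurs_in_horizontal_pair:
  "occurs_in (horizontal_pair a b) x \<longleftrightarrow> (\<exists>i j. x (i, j) = a \<and> x (i + 1, j) = b)"
proof -
  have "(\<forall>u c. horizontal_pair a b u = Some c \<longrightarrow> x ((i, j) + u) = c) \<longleftrightarrow>
      x (i, j) = a \<and> x (i + 1, j) = b" for i j
    by (simp add: horizontal_pair_eq_Some_iff imp_disjL all_conj_distrib)
  then show ?thesis
    unfolding occurs_in_def by (simp only: split_paired_Ex)
qed

lemma vertical_pair_eq_Some_iff:
  "vertical_pair a b u = Some c \<longleftrightarrow> u = (0, 0) \<and> c = a \<or> u = (0, 1) \<and> c = b"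
  by (auto simp: vertical_pair_def)

lemma occurs_in_vertical_pair:
  "occurs_in (vertical_pair a b) x \<longleftrightarrow> (\<exists>i j. x (i, j) = a \<and> x (i, j + 1) = b)"
proof -
  have "(\<forall>u c. vertical_pair a b u = Some c \<longrightarrow> x ((i, j) + u) = c) \<longleftrightarrow>
      x (i, j) = a \<and> x (i, j + 1) = b" for i j
    by (simp add: vertical_pair_eq_Some_iff imp_disjL all_conj_distrib)
  then show ?thesis
    unfolding occurs_in_def by (simp only: split_paired_Ex)
qed

lemma one_step_shift_eq_neighbour_shift:
  assumes "one_step_shift A X"
  obtains H V where "X = neighbour_shift A H V"
proof -
  obtain F where F: "F \<subseteq> adjacent_pairs A" and X: "X = shift_avoiding A F"
    using assms unfolding one_step_shift_def by blast
  define H where "H = {(a, b). horizontal_pair a b \<notin> F}"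
  define V where "V = {(a, b). vertical_pair a b \<notin> F}"
  have "(\<forall>p\<in>F. \<not> occurs_in p x) \<longleftrightarrow>
      (\<forall>i j. (x (i, j), x (i + 1, j)) \<in> H \<and> (x (i, j), x (i, j + 1)) \<in> V)" for x
  proof
    assume avoid: "\<forall>p\<in>F. \<not> occurs_in p x"
    have "horizontal_pair (x (i, j)) (x (i + 1, j)) \<notin> F" for i j
      using avoid occurs_in_horizontal_pair[of "x (i, j)" "x (i + 1, j)" x] by blast
    moreover have "vertical_pair (x (i, j)) (x (i, j + 1)) \<notin> F" for i j
      using avoid occurs_in_vertical_pair[of "x (i, j)" "x (i, j + 1)" x] by blast
    ultimately show "\<forall>i j. (x (i, j), x (i + 1, j)) \<in> H \<and> (x (i, j), x (i, j + 1)) \<in> V"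
      by (simp add: H_def V_def)
  next
    assume *: "\<forall>i j. (x (i, j), x (i + 1, j)) \<in> H \<and> (x (i, j), x (i, j + 1)) \<in> V"
    show "\<forall>p\<in>F. \<not> occurs_in p x"
    proof
      fix p assume "p \<in> F"
      with F consider a b where "p = horizontal_pair a b" | a b where "p = vertical_pair a b"
        unfolding adjacent_pairs_def by blast
      then show "\<not> occurs_in p x"
        using * \<open>p \<in> F\<close> unfolding H_def V_def
        by cases (auto simp: occurs_in_horizontal_pair occurs_in_vertical_pair)
    qed
  qed
  then have "X = neighbour_shift A H V"
    unfolding X shift_avoiding_def neighbour_shift_def by simp
  then show thesis by (rule that)
qed

lemma transpose_in_neighbour_shift:
  assumes "x \<in> neighbour_shift A H V"
  shows "(\<lambda>(i, j). x (j, i)) \<in> neighbour_shift A V H"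
  using assms by (auto simp: neighbour_shift_def)

lemma periodic_point_uminus:
  assumes "periodic_point u x"
  shows "periodic_point (- u) x"
proof -
  have "x (v + - u) = x v" for v
  proof -
    have "x ((v + - u) + u) = x (v + - u)"
      using assms unfolding periodic_point_def by blast
    then show ?thesis by simp
  qed
  then show ?thesis
    using assms by (simp add: periodic_point_def)
qed

text \<open>
  The windows of \<open>2 * N + 1\<close> rows of the strip form a finite set. Only heights that are multiples of
  \<open>N + 1\<close> are compared, because the distance of the two windows has to exceed \<open>N\<close>: then a step of
  size at most \<open>N\<close> leaves the segment between them by less than its length and is brought back by
  a single shift by \<open>p\<close>.
\<close>
lemma strip_window_recurs:
  fixes x :: "'a config" and m N :: int
  assumes "finite A" "range x \<subseteq> A" "N \<ge> 0"
  obtains p s where "p > N"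
    and "\<forall>a\<in>{0..<m}. \<forall>k\<in>{-N..N}. x (a, s + p + k) = x (a, s + k)"
proof -
  let ?D = "{0..<m} \<times> {-N..N}"
  define W where "W t = (\<lambda>z\<in>?D. x (fst z, int t * (N + 1) + snd z))" for t :: nat
  have "range W \<subseteq> ?D \<rightarrow>\<^sub>E A"
    using assms(2) unfolding W_def by (intro image_subsetI restrict_PiE_iff[THEN iffD2]) auto
  moreover have "finite (?D \<rightarrow>\<^sub>E A)"
    using assms(1) by (intro finite_PiE) auto
  ultimately have "finite (range W)"
    by (rule finite_subset)
  then have "\<not> inj W"
    by (metis finite_imageD infinite_UNIV_nat)
  then obtain i j where "i < j" and eq: "W i = W j"
    by (metis injI nat_neq_iff)
  define s p where "s = int i * (N + 1)" and "p = (int j - int i) * (N + 1)"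
  have "1 * (N + 1) \<le> p"
    unfolding p_def using \<open>i < j\<close> assms(3) by (intro mult_right_mono) auto
  then have "p > N" by simp
  moreover have "x (a, s + p + k) = x (a, s + k)" if "(a, k) \<in> ?D" for a k
  proof -
    have "x (a, int i * (N + 1) + k) = x (a, int j * (N + 1) + k)"
      using fun_cong[OF eq, of "(a, k)"] that by (simp add: W_def)
    moreover have "s + p = int j * (N + 1)"
      by (simp add: s_def p_def algebra_simps)
    ultimately show ?thesis by (simp add: s_def)
  qed
  then have "\<forall>a\<in>{0..<m}. \<forall>k\<in>{-N..N}. x (a, s + p + k) = x (a, s + k)"
    by blast
  ultimately show thesis by (rule that)
qed

text \<open>
  Folding all heights into the segment \<open>[s, s + p)\<close> between two equal windows is invisible locally:
  a step of size at most \<open>N\<close> reads the same symbol whether it is taken before or after the folding.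
  Hence every constraint of range at most \<open>N\<close> survives the folding.
\<close>
lemma fold_strip_step:
  fixes x :: "'a config" and s p N a b d :: int
  assumes "p > N" "\<bar>d\<bar> \<le> N"
    and window: "\<And>k. \<bar>k\<bar> \<le> N \<Longrightarrow> x (a, s + p + k) = x (a, s + k)"
  shows "x (a, s + (b + d - s) mod p) = x (a, s + (b - s) mod p + d)"
proof -
  define r where "r = (b - s) mod p"
  have r: "0 \<le> r" "r < p"
    using assms(1,2) by (auto simp: r_def)
  have mod_eq: "(b + d - s) mod p = (r + d) mod p"
  proof -
    have "b + d - s = (b - s) + d" by simp
    then show ?thesis by (simp only: r_def mod_add_left_eq)
  qed
  consider "r + d < 0" | "0 \<le> r + d" "r + d < p" | "p \<le> r + d" by linarith
  then show ?thesis
  proof cases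
    case 1
    have "(r + d) mod p = (r + d + p) mod p" by simp
    also have "\<dots> = r + d + p"
      using 1 r assms(1,2) by (intro mod_pos_pos_trivial) auto
    finally show ?thesis
      using window[of "r + d"] 1 r assms(2) by (simp add: mod_eq r_def[symmetric] algebra_simps)
  next
    case 2
    then show ?thesis by (simp add: mod_eq r_def[symmetric] algebra_simps)
  next
    case 3
    have "(r + d) mod p = (r + d - p) mod p" by simp
    also have "\<dots> = r + d - p"
      using 3 r assms(1,2) by (intro mod_pos_pos_trivial) auto
    finally have "s + (b + d - s) mod p = s + (r + d - p)"
      by (simp only: mod_eq)
    moreover have "x (a, s + p + (r + d - p)) = x (a, s + (r + d - p))"
      using 3 r assms(1,2) by (intro window) auto
    moreover have "s + p + (r + d - p) = s + (b - s) mod p + d"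
      by (simp add: r_def)
    ultimately show ?thesis by (simp only:)
  qed
qed

text \<open>
  The new point consists of copies of the folded strip, each shifted by \<open>(m, n)\<close> against the previous
  one. Vertical neighbours are a step of size \<open>1\<close> apart in the strip. Horizontal neighbours lie in
  the same row of one copy, except at the seam between two copies, which the period \<open>(m, n)\<close> of
  \<open>x\<close> turns into a step of size \<open>\<bar>n\<bar>\<close>.
\<close>
lemma doubly_periodic_point_exists:
  assumes "finite A" and x: "x \<in> neighbour_shift A H V"
    and per: "periodic_point (m, n) x" and "m > 0"
  obtains y p where "y \<in> neighbour_shift A H V" "p > 0"
    "periodic_point (m, n) y" "periodic_point (0, p) y"
proof -
  have range: "range x \<subseteq> A" and H: "(x (i, j), x (i + 1, j)) \<in> H"
    and V: "(x (i, j), x (i, j + 1)) \<in> V" for i j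
    using x by (auto simp: neighbour_shift_def)
  define N where "N = \<bar>n\<bar> + 1"
  have "N \<ge> 0" by (simp add: N_def)
  with assms(1) range obtain p s where p: "p > N"
    and window: "\<forall>a\<in>{0..<m}. \<forall>k\<in>{-N..N}. x (a, s + p + k) = x (a, s + k)"
    by (rule strip_window_recurs)
  have "p > 0" using p by (simp add: N_def)
  define \<rho> where "\<rho> b = s + (b - s) mod p" for b
  have step: "x (a, \<rho> (b + d)) = x (a, \<rho> b + d)" if "0 \<le> a" "a < m" "\<bar>d\<bar> \<le> N" for a b d
    unfolding \<rho>_def using window that by (intro fold_strip_step[OF p]) (auto simp: abs_le_iff)
  define y where "y = (\<lambda>(a, b). x (a mod m, \<rho> (b - n * (a div m))))"
  have "(y (a, b), y (a + 1, b)) \<in> H" for a b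
  proof (cases "a mod m = m - 1")
    case False
    then have "a mod m + 1 < m" "0 \<le> a mod m + 1"
      using pos_mod_bound[OF \<open>m > 0\<close>, of a] pos_mod_sign[OF \<open>m > 0\<close>, of a] by linarith+
    moreover have "a + 1 = m * (a div m) + (a mod m + 1)"
      by simp
    ultimately have "(a + 1) mod m = a mod m + 1" "(a + 1) div m = a div m"
      by (metis int_mod_pos_eq, metis int_div_pos_eq)
    then show ?thesis using H by (simp add: y_def)
  next
    case True
    define c where "c = b - n * (a div m)"
    have "a + 1 = (a div m + 1) * m"
      using True div_mult_mod_eq[of a m] unfolding distrib_right by linarith
    then have "(a + 1) mod m = 0" "(a + 1) div m = a div m + 1"
      using \<open>m > 0\<close> by simp_all
    then have "y (a + 1, b) = x (0, \<rho> (c + - n))"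
      by (simp add: y_def c_def algebra_simps)
    also have "\<dots> = x (0, \<rho> c - n)"
      using step[of 0 "- n" c] \<open>m > 0\<close> by (simp add: N_def)
    also have "\<dots> = x ((0, \<rho> c - n) + (m, n))"
      using per unfolding periodic_point_def by metis
    also have "\<dots> = x (m, \<rho> c)" by simp
    finally show ?thesis
      using H[of "m - 1" "\<rho> c"] True by (simp add: y_def c_def)
  qed
  moreover have "(y (a, b), y (a, b + 1)) \<in> V" for a b
  proof -
    define c where "c = b - n * (a div m)"
    have "y (a, b + 1) = x (a mod m, \<rho> (c + 1))"
      by (simp add: y_def c_def algebra_simps)
    also have "\<dots> = x (a mod m, \<rho> c + 1)"
      using \<open>m > 0\<close> by (intro step) (auto simp: N_def)
    finally show ?thesis
      using V by (simp add: y_def c_def)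
  qed
  moreover have "range y \<subseteq> A"
    using range by (auto simp: y_def)
  ultimately have "y \<in> neighbour_shift A H V"
    by (simp add: neighbour_shift_def)
  moreover have "periodic_point (m, n) y"
    using \<open>m > 0\<close>
    by (auto simp: periodic_point_def y_def zero_prod_def div_add_self2 algebra_simps)
  moreover have "\<rho> (b + p - k) = \<rho> (b - k)" for b k
  proof -
    have "b + p - k - s = (b - k - s) + p" by simp
    then show ?thesis by (simp only: \<rho>_def mod_add_self2)
  qed
  then have "periodic_point (0, p) y"
    using \<open>p > 0\<close> by (auto simp: periodic_point_def y_def zero_prod_def)
  ultimately show thesis
    using \<open>p > 0\<close> that by blast
qed

theorem corollary4:
  fixes A :: "'a set" and X :: "(int \<times> int \<Rightarrow> 'a) set"
  assumes "finite A"
    and "shift_of_finite_type A X"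
    and "one_step_shift A X"
  shows "(\<exists>x\<in>X. vertically_periodic x) \<longleftrightarrow>
    (\<exists>m n. m \<noteq> 0 \<and> n \<noteq> 0 \<and> (\<exists>x\<in>X. periodic_point (m, n) x))"
proof -
  obtain H V where X: "X = neighbour_shift A H V"
    using assms(3) by (rule one_step_shift_eq_neighbour_shift)
  show ?thesis
  proof
    assume "\<exists>x\<in>X. vertically_periodic x"
    then obtain x n where x: "x \<in> X" and "n \<noteq> 0" and per: "periodic_point (0, n) x"
      unfolding vertically_periodic_def by blast
    then have "periodic_point (0, \<bar>n\<bar>) x"
      using periodic_point_uminus[OF per] by (simp add: abs_if)
    then have "periodic_point (\<bar>n\<bar>, 0) (\<lambda>(i, j). x (j, i))"
      by (auto simp: periodic_point_def zero_prod_def)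
    then obtain y p where y: "y \<in> neighbour_shift A V H" and "p > 0"
      and "periodic_point (\<bar>n\<bar>, 0) y" "periodic_point (0, p) y"
      using doubly_periodic_point_exists[OF assms(1) transpose_in_neighbour_shift] x \<open>n \<noteq> 0\<close>
      unfolding X by (metis zero_less_abs_iff)
    then have "y (i + \<bar>n\<bar>, j) = y (i, j)" "y (i, j + p) = y (i, j)" for i j
      by (auto simp: periodic_point_def)
    then have "periodic_point (p, \<bar>n\<bar>) (\<lambda>(i, j). y (j, i))"
      using \<open>p > 0\<close> by (auto simp: periodic_point_def zero_prod_def)
    moreover have "(\<lambda>(i, j). y (j, i)) \<in> X"
      unfolding X using y by (rule transpose_in_neighbour_shift)
    ultimately show "\<exists>m n. m \<noteq> 0 \<and> n \<noteq> 0 \<and> (\<exists>x\<in>X. periodic_point (m, n) x)"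
      using \<open>p > 0\<close> \<open>n \<noteq> 0\<close> by (metis abs_eq_0_iff less_irrefl)
  next
    assume "\<exists>m n. m \<noteq> 0 \<and> n \<noteq> 0 \<and> (\<exists>x\<in>X. periodic_point (m, n) x)"
    then obtain m n x where "m \<noteq> 0" and x: "x \<in> X" and per: "periodic_point (m, n) x"
      by blast
    obtain m' n' where "m' > 0" "periodic_point (m', n') x"
    proof (cases "m > 0")
      case True
      then show thesis using per that by blast
    next
      case False
      then show thesis
        using that[of "- m" "- n"] periodic_point_uminus[OF per] \<open>m \<noteq> 0\<close> by simp
    qed
    then obtain y p where "y \<in> X" "p > 0" "periodic_point (0, p) y"
      using doubly_periodic_point_exists[OF assms(1)] x unfolding X by metis
    then show "\<exists>x\<in>X. vertically_periodic x"
      unfolding vertically_periodic_def by (metis less_irrefl)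
  qed
qed

end
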